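(* Let $G=\{-1,0,1\}$, let $\nu$ be the Haar probability measure on $G^{\mathbb N}$, and for $p>0$ let $$A_p=\{\omega\in G^{\mathbb N}:\Phi_\omega\in L^p(0,\infty)\},\qquad \Phi_\omega(t)=\sum_{n=1}^\infty\omega(n)e^{-nt}\quad(t>0).$$ For $0<p<1$, $A_p=G^{\mathbb N}$. For $1\le p<2$, $\nu(A_p)=1$, but $A_p$ is meagre in $G^{\mathbb N}$. Equivalently (for $1\le p<2$), $G^{\mathbb N}\setminus A_p$ has $\nu$-measure zero and contains a dense $G_\delta$ set.
   Context: $\mathbb N=\{1,2,3,\dots\}$. $G=\{-1,0,1\}$ is identified with the group $\mathbb Z/3\mathbb Z$ with the discrete topology, $G^{\mathbb N}$ carries the product topology, and $\nu$ is the product of the uniform probability measures on $G$. For $p>0$ (including $p<1$), $\Phi_\omega\in L^p(0,\infty)$ means $\int_0^\infty|\Phi_\omega(t)|^p\,dt<\infty$. A set is meagre if it is a countable union of nowhere dense sets. *)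

theory Defs
  imports "HOL-Analysis.Analysis"
begin

definition G :: "int set"
  where "G = {-1, 0, 1}"

text \<open>The index set is the positive integers. Elements of the product are extensional functions,
  i.e. they take the value \<open>undefined\<close> at the index \<open>0\<close>, which never enters below.\<close>

definition Gseq :: "(nat \<Rightarrow> int) set"
  where "Gseq = (\<Pi>\<^sub>E n\<in>{1..}. G)"

definition Gseq_topology :: "(nat \<Rightarrow> int) topology"
  where "Gseq_topology = product_topology (\<lambda>n. discrete_topology G) {1..}"

text \<open>The normalised Haar measure of the compact group \<open>(\<int>/3\<int>)\<^sup>\<nat>\<close> is the product of the
  uniform probability measures on the factors.\<close>

definition \<nu> :: "(nat \<Rightarrow> int) measure"
  where "\<nu> = (\<Pi>\<^sub>M n\<in>{1..}. uniform_count_measure G)"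

lemma topspace_Gseq_topology: "topspace Gseq_topology = Gseq"
  by (simp add: Gseq_topology_def Gseq_def)

lemma space_nu: "space \<nu> = Gseq"
  by (simp add: \<nu>_def Gseq_def space_PiM space_uniform_count_measure)

definition \<Phi> :: "(nat \<Rightarrow> int) \<Rightarrow> real \<Rightarrow> real"
  where "\<Phi> \<omega> t = (\<Sum>n. of_int (\<omega> (Suc n)) * exp (- (real (Suc n) * t)))"

lemma summable_Phi:
  assumes "\<omega> \<in> Gseq" and "t > 0"
  shows "summable (\<lambda>n. of_int (\<omega> (Suc n)) * exp (- (real (Suc n) * t)))"
proof (rule summable_comparison_test')
  show "summable (\<lambda>n. exp (- t) ^ Suc n)"
    using assms(2) by (simp add: summable_geometric)
  fix n :: nat
  have "\<omega> (Suc n) \<in> G"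
    using assms(1) by (auto simp: Gseq_def PiE_iff)
  then have "\<bar>real_of_int (\<omega> (Suc n))\<bar> \<le> 1"
    by (auto simp: G_def)
  moreover have "exp (- (real (Suc n) * t)) = exp (- t) ^ Suc n"
    using exp_of_nat_mult[of "Suc n" "- t"] by simp
  ultimately show "norm (of_int (\<omega> (Suc n)) * exp (- (real (Suc n) * t))) \<le> exp (- t) ^ Suc n"
    by (simp add: abs_mult mult_left_le_one_le)
qed

text \<open>Membership in \<open>L\<^sup>p(S)\<close> for arbitrary \<open>p > 0\<close>, including \<open>p < 1\<close>.\<close>

definition in_Lp :: "real \<Rightarrow> real set \<Rightarrow> (real \<Rightarrow> real) \<Rightarrow> bool"
  where "in_Lp p S f \<longleftrightarrow>
    set_borel_measurable lborel S f \<and> (\<integral>\<^sup>+ t\<in>S. ennreal (\<bar>f t\<bar> powr p) \<partial>lborel) < \<infinity>"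

definition A :: "real \<Rightarrow> (nat \<Rightarrow> int) set"
  where "A p = {\<omega> \<in> Gseq. in_Lp p {0<..} (\<Phi> \<omega>)}"

definition nowhere_dense_in :: "'a topology \<Rightarrow> 'a set \<Rightarrow> bool"
  where "nowhere_dense_in X S \<longleftrightarrow>
    S \<subseteq> topspace X \<and> X interior_of (X closure_of S) = {}"

definition meagre_in :: "'a topology \<Rightarrow> 'a set \<Rightarrow> bool"
  where "meagre_in X S \<longleftrightarrow>
    (\<exists>\<F>. countable \<F> \<and> (\<forall>N\<in>\<F>. nowhere_dense_in X N) \<and> S = \<Union>\<F>)"

definition dense_in :: "'a topology \<Rightarrow> 'a set \<Rightarrow> bool"
  where "dense_in X S \<longleftrightarrow> S \<subseteq> topspace X \<and> X closure_of S = topspace X"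

end

theory Submission
  imports Defs "HOL-Probability.Independent_Family"
begin

text \<open>
  Since \<open>\<bar>\<Phi> \<omega> t\<bar> \<le> h t\<close> for \<open>h t = 1 / (exp t - 1)\<close>, and \<open>h\<close> is \<open>O(1 / t)\<close> at the origin and
  decays exponentially, \<open>h\<^sup>q\<close> is integrable for \<open>0 < q < 1\<close>; this settles \<open>p < 1\<close>.
  The coordinates are orthogonal in \<open>L\<^sup>2(\<nu>)\<close>, so the second moment of \<open>\<Phi> \<omega> t\<close> is at most \<open>h t\<close> and
  its \<open>p\<close>-th moment is \<open>O(h(t) powr (p / 2))\<close>, which is integrable in \<open>t\<close> for \<open>p < 2\<close>; by Tonelli
  almost every \<open>\<omega>\<close> lies in \<open>A p\<close>.
  For \<open>p \<ge> 1\<close>, membership in \<open>A p\<close> bounds the integrals of \<open>\<Phi> \<omega>\<close> over \<open>{\<epsilon>..1}\<close> uniformly in \<open>\<epsilon>\<close>.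
  The sequences for which one of these integrals exceeds \<open>k\<close> form an open set, because on \<open>{\<epsilon>..1}\<close>
  the function \<open>\<Phi> \<omega>\<close> depends little on the far coordinates of \<open>\<omega>\<close>. All these open sets contain the
  dense set of sequences that are eventually \<open>1\<close>, for which \<open>\<Phi> \<omega> t\<close> is \<open>1 / t\<close> up to a bounded error;
  so no appeal to Baire's theorem is needed.
\<close>

section \<open>Pointwise estimates for \<open>\<Phi>\<close>\<close>

lemma abs_of_int_Gseq_le:
  assumes "\<omega> \<in> Gseq" and "n \<ge> 1"
  shows "\<bar>real_of_int (\<omega> n)\<bar> \<le> 1"
proof -
  have "\<omega> n \<in> G"
    using assms by (auto simp: Gseq_def PiE_iff)
  then show ?thesis
    by (auto simp: G_def)
qed

lemma exp_minus_Suc_mult: "exp (- (real (Suc n) * t)) = exp (- t) ^ Suc n" for t :: real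
  using exp_of_nat_mult[of "Suc n" "- t"] by simp

lemma sums_exp_minus_Suc:
  fixes t :: real
  assumes "t > 0"
  shows "(\<lambda>n. exp (- (real (Suc n) * t))) sums (1 / (exp t - 1))"
proof -
  have "(\<lambda>n. exp (- t) * exp (- t) ^ n) sums (exp (- t) * (1 / (1 - exp (- t))))"
    using assms by (intro sums_mult geometric_sums) simp
  moreover have "exp (- t) * (1 / (1 - exp (- t))) = 1 / (exp t - 1)"
    using assms by (simp add: exp_minus field_simps)
  ultimately show ?thesis
    by (simp add: exp_minus_Suc_mult del: of_nat_Suc)
qed

lemma Phi_sums:
  assumes "\<omega> \<in> Gseq" and "t > 0"
  shows "(\<lambda>n. of_int (\<omega> (Suc n)) * exp (- (real (Suc n) * t))) sums \<Phi> \<omega> t"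
  unfolding \<Phi>_def using summable_Phi[OF assms] by (rule summable_sums)

lemma abs_Phi_le:
  assumes "\<omega> \<in> Gseq" and "t > 0"
  shows "\<bar>\<Phi> \<omega> t\<bar> \<le> 1 / (exp t - 1)"
proof -
  have "norm (\<Phi> \<omega> t) \<le> (\<Sum>n. exp (- (real (Suc n) * t)))"
    unfolding \<Phi>_def
  proof (rule norm_suminf_le)
    fix n
    show "norm (of_int (\<omega> (Suc n)) * exp (- (real (Suc n) * t))) \<le> exp (- (real (Suc n) * t))"
      using abs_of_int_Gseq_le[OF assms(1), of "Suc n"]
      by (simp add: abs_mult mult_left_le_one_le)
  qed (use sums_exp_minus_Suc[OF assms(2)] in \<open>simp add: sums_iff\<close>)
  then show ?thesis
    using sums_exp_minus_Suc[OF assms(2)] by (simp add: sums_iff)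
qed

text \<open>The first \<open>N\<close> terms cancel and every later coefficient differs by at most
  2, so the error is twice a geometric tail. It decreases in \<open>t\<close>, hence is uniform for
  \<open>t \<ge> \<epsilon>\<close> and tends to 0 as \<open>N\<close> grows; openness of
  \<open>large_integral\<close> rests on this.\<close>

lemma Phi_agree_le:
  assumes "\<omega> \<in> Gseq" and "\<omega>' \<in> Gseq" and agree: "\<And>n. 1 \<le> n \<Longrightarrow> n \<le> N \<Longrightarrow> \<omega> n = \<omega>' n"
    and t: "0 < \<epsilon>" "\<epsilon> \<le> t"
  shows "\<bar>\<Phi> \<omega> t - \<Phi> \<omega>' t\<bar> \<le> 2 * exp (- (real N * \<epsilon>)) / (exp \<epsilon> - 1)"
proof -
  have t0: "0 < t" using t by simp
  define d where "d n = (of_int (\<omega> (Suc n)) - of_int (\<omega>' (Suc n))) * exp (- (real (Suc n) * t))" for n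
  have d: "d sums (\<Phi> \<omega> t - \<Phi> \<omega>' t)"
    unfolding d_def left_diff_distrib using assms t0 by (intro sums_diff Phi_sums)
  have "d n = 0" if "n < N" for n
    using that agree[of "Suc n"] by (simp add: d_def)
  then have "(\<Sum>n<N. d n) = 0" by simp
  then have dN: "(\<lambda>n. d (n + N)) sums (\<Phi> \<omega> t - \<Phi> \<omega>' t)"
    using d by (subst sums_iff_shift) simp
  have g: "(\<lambda>n. 2 * exp (- (real N * t)) * exp (- (real (Suc n) * t))) sums
      (2 * exp (- (real N * t)) * (1 / (exp t - 1)))"
    by (intro sums_mult sums_exp_minus_Suc t0)
  have "norm (\<Sum>n. d (n + N)) \<le> (\<Sum>n. 2 * exp (- (real N * t)) * exp (- (real (Suc n) * t)))"
  proof (rule norm_suminf_le)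
    fix n
    have "\<bar>real_of_int (\<omega> (Suc (n + N))) - real_of_int (\<omega>' (Suc (n + N)))\<bar> \<le> 2"
      using abs_of_int_Gseq_le[OF assms(1), of "Suc (n + N)"]
        abs_of_int_Gseq_le[OF assms(2), of "Suc (n + N)"] by simp
    moreover have "exp (- (real (Suc (n + N)) * t)) = exp (- (real N * t)) * exp (- (real (Suc n) * t))"
      by (simp add: exp_add[symmetric] algebra_simps)
    ultimately show "norm (d (n + N)) \<le> 2 * exp (- (real N * t)) * exp (- (real (Suc n) * t))"
      by (simp add: d_def abs_mult mult.assoc)
  qed (use g in \<open>simp add: sums_iff\<close>)
  then have "\<bar>\<Phi> \<omega> t - \<Phi> \<omega>' t\<bar> \<le> 2 * exp (- (real N * t)) / (exp t - 1)"
    using g dN by (simp add: sums_iff)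
  also have "\<dots> \<le> 2 * exp (- (real N * \<epsilon>)) / (exp \<epsilon> - 1)"
    using t by (intro frac_le) (auto intro: mult_left_mono)
  finally show ?thesis .
qed

text \<open>The full series with all coefficients 1 sums to \<open>1 / (exp t - 1)\<close>.
  Replacing them by those of \<open>\<omega>\<close> changes at most \<open>N\<close> terms, each
  lowered by at most 2; the remaining 1 is lost in passing from \<open>1 / (exp t - 1)\<close> to
  \<open>1 / t\<close>.\<close>

lemma Phi_eventually_one_ge:
  assumes "\<omega> \<in> Gseq" and one: "\<And>n. n > N \<Longrightarrow> \<omega> n = 1" and t: "t > 0"
  shows "\<Phi> \<omega> t \<ge> 1 / t - (2 * real N + 1)"
proof -
  define d where "d n = (1 - of_int (\<omega> (Suc n))) * exp (- (real (Suc n) * t))" for n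
  have d: "d sums (1 / (exp t - 1) - \<Phi> \<omega> t)"
    unfolding d_def left_diff_distrib mult_1 using assms
    by (intro sums_diff Phi_sums sums_exp_minus_Suc)
  have "d sums (\<Sum>n<N. d n)"
    by (rule sums_finite) (auto simp: d_def one)
  with d have "1 / (exp t - 1) - \<Phi> \<omega> t = (\<Sum>n<N. d n)"
    by (rule sums_unique2)
  also have "\<dots> \<le> (\<Sum>n<N. 2)"
  proof (rule sum_mono)
    fix n
    have "1 - real_of_int (\<omega> (Suc n)) \<le> 2"
      using abs_of_int_Gseq_le[OF assms(1), of "Suc n"] by simp
    then have "d n \<le> 2 * exp (- (real (Suc n) * t))"
      unfolding d_def by (intro mult_right_mono) auto
    also have "\<dots> \<le> 2 * 1"
      using t by (intro mult_left_mono) auto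
    finally show "d n \<le> 2" by simp
  qed
  finally have "1 / (exp t - 1) - 2 * real N \<le> \<Phi> \<omega> t" by simp
  moreover have "1 / t - 1 \<le> 1 / (exp t - 1)"
  proof -
    \<comment> \<open>Cleared of denominators, the claim reads
      \<open>(1 - t) * exp t \<le> 1\<close>, that is, \<open>1 - t \<le> exp (- t)\<close>.\<close>
    have "(1 - t) * exp t \<le> exp (- t) * exp t"
      using exp_ge_add_one_self[of "- t"] by (intro mult_right_mono) auto
    then have "(1 - t) * exp t \<le> 1"
      by (simp add: exp_minus)
    moreover have "0 < exp t - 1" using t by simp
    ultimately show ?thesis
      using t by (simp add: divide_simps) (simp add: algebra_simps)
  qed
  ultimately show ?thesis by simp
qed

section \<open>Measurability and integrability in \<open>t\<close>; the case
  \<open>p < 1\<close>\<close>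

lemma measurable_Phi [measurable]: "\<Phi> \<omega> \<in> borel_measurable borel"
  unfolding \<Phi>_def[abs_def] by measurable

text \<open>Up to a constant the integrand is dominated by the Gamma integrand
  \<open>t powr (- q) * exp (- (q / 2 * t))\<close>, which is integrable at the origin because
  \<open>q < 1\<close> and at infinity because \<open>q > 0\<close>.\<close>

lemma nn_integral_bound_powr_finite:
  fixes q :: real
  assumes "0 < q" and "q < 1"
  shows "(\<integral>\<^sup>+ t\<in>{0<..}. ennreal ((1 / (exp t - 1)) powr q) \<partial>lborel) < \<infinity>"
proof -
  \<comment> \<open>The exponent is complex only to match
    \<open>absolutely_integrable_Gamma_integral\<close>; \<open>g\<close> is the modulus of
    \<open>f\<close> on the positive half-line.\<close>
  define z where "z = complex_of_real (1 - q)"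
  define f where "f = (\<lambda>t. complex_of_real t powr (z - 1) / of_real (exp (q / 2 * t)))"
  define g where "g t = t powr (- q) * exp (- (t / 2)) powr q" for t :: real
  have norm_f: "norm (f t) = g t" if "t > 0" for t
  proof -
    have "norm (f t) = t powr (- q) / exp (q / 2 * t)"
      unfolding f_def norm_divide norm_of_real
      using that by (subst norm_powr_real_powr) (auto simp: z_def)
    also have "\<dots> = t powr (- q) * exp (- (q / 2 * t))"
      by (simp only: exp_minus divide_inverse)
    also have "exp (- (q / 2 * t)) = exp (- (t / 2)) powr q"
      by (simp add: exp_powr_real mult.commute)
    finally show ?thesis by (simp add: g_def)
  qed
  have le: "(1 / (exp t - 1)) powr q \<le> 2 powr q * g t" if t: "t > 0" for t
  proof -
    \<comment> \<open>Factoring \<open>exp t - 1\<close> as a difference of squares gives a lower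
      bound that is linear at the origin and still exponential at infinity.\<close>
    have "t / 2 * exp (t / 2) \<le> (exp (t / 2) - 1) * (exp (t / 2) + 1)"
      using exp_ge_add_one_self[of "t / 2"] t by (intro mult_mono) linarith+
    also have "\<dots> = exp t - 1"
      by (simp add: algebra_simps exp_add[symmetric])
    finally have "1 / (exp t - 1) \<le> 1 / (t / 2 * exp (t / 2))"
      using t by (intro divide_left_mono) auto
    then have "(1 / (exp t - 1)) powr q \<le> (2 * (1 / t) * exp (- (t / 2))) powr q"
      using t assms by (intro powr_mono2) (auto simp: exp_minus field_simps)
    also have "\<dots> = 2 powr q * g t"
      using t by (simp only: g_def powr_mult powr_minus powr_one_eq_one powr_divide) (simp add: field_simps)
    finally show ?thesis .
  qed
  have "f absolutely_integrable_on {0<..}"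
    unfolding f_def using assms by (intro absolutely_integrable_Gamma_integral) (auto simp: z_def)
  then have "(\<integral>\<^sup>+ t. ennreal (norm (indicator {0<..} t *\<^sub>R f t)) \<partial>lebesgue) < \<infinity>"
    by (simp add: set_integrable_def integrable_iff_bounded)
  also have "(\<integral>\<^sup>+ t. ennreal (norm (indicator {0<..} t *\<^sub>R f t)) \<partial>lebesgue)
      = (\<integral>\<^sup>+ t\<in>{0<..}. ennreal (g t) \<partial>lebesgue)"
    by (intro nn_integral_cong) (simp add: norm_f split: split_indicator)
  finally have fin: "(\<integral>\<^sup>+ t\<in>{0<..}. ennreal (g t) \<partial>lborel) < \<infinity>"
    by (simp add: nn_integral_completion)
  have [measurable]: "g \<in> borel_measurable borel"
    unfolding g_def[abs_def] by measurable
  have "(\<integral>\<^sup>+ t\<in>{0<..}. ennreal ((1 / (exp t - 1)) powr q) \<partial>lborel)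
      \<le> (\<integral>\<^sup>+ t. ennreal (2 powr q) * (ennreal (g t) * indicator {0<..} t) \<partial>lborel)"
    using le by (intro nn_integral_mono)
      (auto simp: g_def ennreal_mult[symmetric] split: split_indicator intro!: ennreal_leI)
  also have "\<dots> = ennreal (2 powr q) * (\<integral>\<^sup>+ t\<in>{0<..}. ennreal (g t) \<partial>lborel)"
    by (intro nn_integral_cmult) measurable
  also have "\<dots> < \<infinity>"
    using fin by (simp add: ennreal_mult_less_top)
  finally show ?thesis .
qed

lemma A_eq_Gseq:
  assumes "0 < p" and "p < 1"
  shows "A p = Gseq"
proof -
  have "in_Lp p {0<..} (\<Phi> \<omega>)" if \<omega>: "\<omega> \<in> Gseq" for \<omega>
    unfolding in_Lp_def
  proof
    show "set_borel_measurable lborel {0<..} (\<Phi> \<omega>)"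
      unfolding set_borel_measurable_def by measurable
    have "(\<integral>\<^sup>+ t\<in>{0<..}. ennreal (\<bar>\<Phi> \<omega> t\<bar> powr p) \<partial>lborel)
        \<le> (\<integral>\<^sup>+ t\<in>{0<..}. ennreal ((1 / (exp t - 1)) powr p) \<partial>lborel)"
      using abs_Phi_le[OF \<omega>] assms
      by (intro nn_integral_mono)
        (auto split: split_indicator intro!: ennreal_leI powr_mono2)
    then show "(\<integral>\<^sup>+ t\<in>{0<..}. ennreal (\<bar>\<Phi> \<omega> t\<bar> powr p) \<partial>lborel) < \<infinity>"
      using nn_integral_bound_powr_finite[OF assms] by (rule le_less_trans)
  qed
  then show ?thesis
    by (auto simp: A_def)
qed

section \<open>Coordinates as random variables and the moments of
  \<open>\<Phi> \<omega> t\<close>\<close>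

interpretation coordinates: product_prob_space "\<lambda>_. uniform_count_measure G" "{1::nat..}"
  by (simp add: product_prob_spaceI prob_space_uniform_count_measure G_def)

lemma prob_space_nu: "prob_space \<nu>"
  unfolding \<nu>_def by (rule coordinates.prob_space_axioms)

interpretation nu: prob_space \<nu>
  by (rule prob_space_nu)

lemma measurable_uniform_count_measure_G:
  fixes f :: "int \<Rightarrow> real"
  shows "f \<in> borel_measurable (uniform_count_measure G)"
  by (simp add: measurable_def space_uniform_count_measure sets_uniform_count_measure)

lemma measurable_coordinate:
  "n \<ge> 1 \<Longrightarrow> (\<lambda>\<omega>. \<omega> n) \<in> measurable \<nu> (uniform_count_measure G)"
  unfolding \<nu>_def by (rule measurable_component_singleton) simp

lemma measurable_of_int_coordinate [measurable]:
  "(\<lambda>\<omega>. real_of_int (\<omega> (Suc n))) \<in> borel_measurable \<nu>"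
  by (rule measurable_compose[OF measurable_coordinate measurable_uniform_count_measure_G]) simp

lemma integral_coordinate:
  fixes f :: "int \<Rightarrow> real"
  assumes "n \<ge> 1"
  shows "(\<integral>\<omega>. f (\<omega> n) \<partial>\<nu>) = (f (-1) + f 0 + f 1) / 3"
proof -
  have "(\<integral>\<omega>. f (\<omega> n) \<partial>\<nu>) = (\<integral>x. f x \<partial>distr \<nu> (uniform_count_measure G) (\<lambda>\<omega>. \<omega> n))"
    using measurable_coordinate[OF assms] measurable_uniform_count_measure_G
    by (rule integral_distr[symmetric])
  also have "distr \<nu> (uniform_count_measure G) (\<lambda>\<omega>. \<omega> n) = uniform_count_measure G"
    unfolding \<nu>_def using assms by (intro coordinates.PiM_component) simp
  finally show ?thesis
    by (simp add: integral_uniform_count_measure G_def)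
qed

text \<open>Independence means that the joint law is the product of the marginals. Restriction to
  \<open>{1..}\<close> is the identity on extensional functions, so the joint law is
  \<open>\<nu>\<close> itself.\<close>

lemma indep_coordinates:
  "nu.indep_vars (\<lambda>_. uniform_count_measure G) (\<lambda>n \<omega>. \<omega> n) {1..}"
proof (subst nu.indep_vars_iff_distr_eq_PiM')
  have "distr \<nu> (\<Pi>\<^sub>M n\<in>{1..}. uniform_count_measure G) (\<lambda>\<omega>. \<lambda>n\<in>{1..}. \<omega> n) = distr \<nu> \<nu> (\<lambda>\<omega>. \<omega>)"
    by (rule distr_cong) (auto simp: \<nu>_def space_PiM PiE_restrict)
  also have "\<dots> = \<nu>"
    by (rule distr_id)
  also have "\<dots> = (\<Pi>\<^sub>M n\<in>{1..}. distr \<nu> (uniform_count_measure G) (\<lambda>\<omega>. \<omega> n))"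
    unfolding \<nu>_def by (intro PiM_cong refl coordinates.PiM_component[symmetric])
  finally show "distr \<nu> (\<Pi>\<^sub>M n\<in>{1..}. uniform_count_measure G) (\<lambda>\<omega>. \<lambda>n\<in>{1..}. \<omega> n)
      = (\<Pi>\<^sub>M n\<in>{1..}. distr \<nu> (uniform_count_measure G) (\<lambda>\<omega>. \<omega> n))" .
qed (auto intro: measurable_coordinate)

lemma integrable_coordinate: "integrable \<nu> (\<lambda>\<omega>. real_of_int (\<omega> (Suc n)))"
  by (rule nu.integrable_const_bound[where B = 1])
    (auto simp: space_nu intro!: AE_I2 abs_of_int_Gseq_le)

lemma integrable_coordinate_mult:
  "integrable \<nu> (\<lambda>\<omega>. real_of_int (\<omega> (Suc m)) * real_of_int (\<omega> (Suc n)))"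
  by (rule nu.integrable_const_bound[where B = 1])
    (auto simp: space_nu abs_mult intro!: AE_I2 mult_le_one abs_of_int_Gseq_le)

text \<open>Off the diagonal, independence splits the integral into means, which vanish by symmetry
  of \<open>G\<close>; the diagonal value is the variance of one coordinate.\<close>

lemma integral_coordinate_mult:
  "(\<integral>\<omega>. real_of_int (\<omega> (Suc m)) * real_of_int (\<omega> (Suc n)) \<partial>\<nu>) = (if m = n then 2 / 3 else 0)"
proof (cases "m = n")
  case True
  then show ?thesis
    using integral_coordinate[of "Suc n" "\<lambda>x. real_of_int x * real_of_int x"] by simp
next
  case False
  have "nu.indep_vars (\<lambda>_. borel) (\<lambda>n \<omega>. real_of_int (\<omega> n)) {Suc m, Suc n}"
    by (rule nu.indep_vars_compose2[OF nu.indep_vars_subset[OF indep_coordinates]])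
      (auto intro: measurable_uniform_count_measure_G)
  then have "(\<integral>\<omega>. (\<Prod>i\<in>{Suc m, Suc n}. real_of_int (\<omega> i)) \<partial>\<nu>)
      = (\<Prod>i\<in>{Suc m, Suc n}. \<integral>\<omega>. real_of_int (\<omega> i) \<partial>\<nu>)"
    by (intro nu.indep_vars_lebesgue_integral) (auto intro: integrable_coordinate)
  also have "\<dots> = 0"
    using integral_coordinate[of "Suc n" real_of_int] by simp
  finally show ?thesis
    using False by simp
qed

text \<open>Expanding the square leaves only the diagonal, with a factor \<open>2 / 3\<close> that
  is then bounded by 1.\<close>

lemma nn_integral_square_sum_le:
  "(\<integral>\<^sup>+ \<omega>. ennreal ((\<Sum>n<N. of_int (\<omega> (Suc n)) * c n)\<^sup>2) \<partial>\<nu>) \<le> ennreal (\<Sum>n<N. (c n)\<^sup>2)"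
proof -
  have eq: "(\<Sum>n<N. real_of_int (\<omega> (Suc n)) * c n)\<^sup>2
      = (\<Sum>m<N. \<Sum>n<N. c m * c n * (real_of_int (\<omega> (Suc m)) * real_of_int (\<omega> (Suc n))))" for \<omega>
    by (simp add: power2_eq_square sum_product mult_ac)
  have "integrable \<nu> (\<lambda>\<omega>. (\<Sum>n<N. real_of_int (\<omega> (Suc n)) * c n)\<^sup>2)"
    unfolding eq by (intro Bochner_Integration.integrable_sum integrable_mult_right integrable_coordinate_mult)
  then have "(\<integral>\<^sup>+ \<omega>. ennreal ((\<Sum>n<N. of_int (\<omega> (Suc n)) * c n)\<^sup>2) \<partial>\<nu>)
      = ennreal (\<integral>\<omega>. (\<Sum>n<N. real_of_int (\<omega> (Suc n)) * c n)\<^sup>2 \<partial>\<nu>)"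
    by (intro nn_integral_eq_integral) auto
  also have "(\<integral>\<omega>. (\<Sum>n<N. real_of_int (\<omega> (Suc n)) * c n)\<^sup>2 \<partial>\<nu>)
      = (\<Sum>m<N. \<Sum>n<N. c m * c n * (if m = n then 2 / 3 else 0))"
    unfolding eq
    by (simp add: Bochner_Integration.integral_sum Bochner_Integration.integrable_sum
        integrable_coordinate_mult integral_coordinate_mult)
  also have "\<dots> = (\<Sum>m<N. 2 / 3 * (c m)\<^sup>2)"
    by (intro sum.cong) (simp_all add: if_distrib[of "\<lambda>x. _ * x"] power2_eq_square cong: if_cong)
  also have "\<dots> \<le> (\<Sum>m<N. (c m)\<^sup>2)"
    by (intro sum_mono) simp
  finally show ?thesis
    by (simp add: ennreal_leI)
qed

text \<open>Joint measurability is what the interchange of integrals in \<open>AE_in_A\<close>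
  relies on.\<close>

lemma measurable_Phi_pair [measurable]:
  "(\<lambda>(\<omega>, t). \<Phi> \<omega> t) \<in> borel_measurable (\<nu> \<Otimes>\<^sub>M borel)"
proof -
  have [measurable]: "(\<lambda>x. real_of_int (fst x (Suc n))) \<in> borel_measurable (\<nu> \<Otimes>\<^sub>M borel)"
    for n
    by (rule measurable_compose[OF measurable_fst measurable_of_int_coordinate])
  show ?thesis
    unfolding \<Phi>_def[abs_def] case_prod_beta by measurable
qed

text \<open>Fatou's lemma carries the bound for finite sums over to the series, so convergence in
  mean square need not be discussed.\<close>

lemma nn_integral_Phi_square_le:
  assumes t: "t > 0"
  shows "(\<integral>\<^sup>+ \<omega>. ennreal ((\<Phi> \<omega> t)\<^sup>2) \<partial>\<nu>) \<le> ennreal (1 / (exp t - 1))"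
proof -
  define S where "S N \<omega> = (\<Sum>n<N. of_int (\<omega> (Suc n)) * exp (- (real (Suc n) * t)))" for N and \<omega> :: "nat \<Rightarrow> int"
  have "(\<integral>\<^sup>+ \<omega>. ennreal ((\<Phi> \<omega> t)\<^sup>2) \<partial>\<nu>) = (\<integral>\<^sup>+ \<omega>. liminf (\<lambda>N. ennreal ((S N \<omega>)\<^sup>2)) \<partial>\<nu>)"
  proof (rule nn_integral_cong)
    fix \<omega> assume "\<omega> \<in> space \<nu>"
    then have "(\<lambda>N. S N \<omega>) \<longlonglongrightarrow> \<Phi> \<omega> t"
      using Phi_sums[OF _ t] by (simp add: space_nu sums_def S_def)
    then have "(\<lambda>N. ennreal ((S N \<omega>)\<^sup>2)) \<longlonglongrightarrow> ennreal ((\<Phi> \<omega> t)\<^sup>2)"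
      by (intro tendsto_intros)
    then show "ennreal ((\<Phi> \<omega> t)\<^sup>2) = liminf (\<lambda>N. ennreal ((S N \<omega>)\<^sup>2))"
      by (rule lim_imp_Liminf[symmetric, rotated]) simp
  qed
  also have "\<dots> \<le> liminf (\<lambda>N. \<integral>\<^sup>+ \<omega>. ennreal ((S N \<omega>)\<^sup>2) \<partial>\<nu>)"
    unfolding S_def by (intro nn_integral_liminf) measurable
  also have "\<dots> \<le> liminf (\<lambda>N::nat. ennreal (1 / (exp t - 1)))"
  proof (intro Liminf_mono always_eventually allI)
    fix N
    \<comment> \<open>Each exponential is at most 1, so its square is no larger; the bound is then
      the same geometric series that dominates \<open>\<Phi>\<close> itself.\<close>
    have "(\<Sum>n<N. (exp (- (real (Suc n) * t)))\<^sup>2) \<le> (\<Sum>n<N. exp (- (real (Suc n) * t)))"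
      using t by (intro sum_mono) (simp add: power2_eq_square mult_left_le)
    also have "\<dots> \<le> (\<Sum>n. exp (- (real (Suc n) * t)))"
      using sums_exp_minus_Suc[OF t] by (intro sum_le_suminf) (auto simp: sums_iff)
    also have "\<dots> = 1 / (exp t - 1)"
      using sums_exp_minus_Suc[OF t] by (simp add: sums_iff)
    finally show "(\<integral>\<^sup>+ \<omega>. ennreal ((S N \<omega>)\<^sup>2) \<partial>\<nu>) \<le> ennreal (1 / (exp t - 1))"
      unfolding S_def by (intro order_trans[OF nn_integral_square_sum_le] ennreal_leI)
  qed
  finally show ?thesis
    by (simp add: Liminf_const)
qed

text \<open>With \<open>a\<^sup>2\<close> a bound for the second moment, this replaces Jensen's inequality for the \<open>p\<close>-th moment.\<close>

lemma powr_le_truncation: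
  fixes a p x :: real
  assumes "0 < a" and "0 \<le> p" and "p \<le> 2"
  shows "\<bar>x\<bar> powr p \<le> a powr p + a powr (p - 2) * x\<^sup>2"
proof (cases "\<bar>x\<bar> \<le> a")
  case True
  then have "\<bar>x\<bar> powr p \<le> a powr p"
    using assms by (intro powr_mono2) auto
  then show ?thesis
    by (simp add: add_increasing2)
next
  case False
  have "\<bar>x\<bar> powr p = \<bar>x\<bar> powr (p - 2) * \<bar>x\<bar> powr 2"
    by (simp only: powr_add[symmetric]) simp
  also have "\<bar>x\<bar> powr 2 = x\<^sup>2"
    by simp
  also have "\<bar>x\<bar> powr (p - 2) * x\<^sup>2 \<le> a powr (p - 2) * x\<^sup>2"
    using False assms by (intro mult_right_mono powr_mono2') auto
  finally show ?thesis
    by (simp add: add_increasing)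
qed

lemma nn_integral_Phi_powr_le:
  assumes t: "t > 0" and p: "0 < p" "p \<le> 2"
  shows "(\<integral>\<^sup>+ \<omega>. ennreal (\<bar>\<Phi> \<omega> t\<bar> powr p) \<partial>\<nu>) \<le> ennreal (2 * (1 / (exp t - 1)) powr (p / 2))"
proof -
  define b where "b = 1 / (exp t - 1)"
  \<comment> \<open>The truncation level is the square root of the second-moment bound
    \<open>b\<close>. Then \<open>a powr p\<close> and \<open>a powr (p - 2) * b\<close> both equal
    \<open>b powr (p / 2)\<close>, whence the factor 2.\<close>
  define a where "a = b powr (1 / 2)"
  have b: "b > 0" using t by (simp add: b_def)
  then have a: "a > 0" by (simp add: a_def)
  have [measurable]: "(\<lambda>\<omega>. \<Phi> \<omega> t) \<in> borel_measurable \<nu>"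
    unfolding \<Phi>_def by measurable
  have "(\<integral>\<^sup>+ \<omega>. ennreal (\<bar>\<Phi> \<omega> t\<bar> powr p) \<partial>\<nu>)
      \<le> (\<integral>\<^sup>+ \<omega>. (ennreal (a powr p) + ennreal (a powr (p - 2)) * ennreal ((\<Phi> \<omega> t)\<^sup>2)) \<partial>\<nu>)"
    using powr_le_truncation[OF a, of p] p
    by (intro nn_integral_mono) (simp flip: ennreal_mult ennreal_plus add: ennreal_leI)
  also have "\<dots> = ennreal (a powr p)
      + ennreal (a powr (p - 2)) * (\<integral>\<^sup>+ \<omega>. ennreal ((\<Phi> \<omega> t)\<^sup>2) \<partial>\<nu>)"
    by (simp add: nn_integral_add nn_integral_cmult nu.emeasure_space_1)
  also have "\<dots> \<le> ennreal (a powr p) + ennreal (a powr (p - 2)) * ennreal b"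
    unfolding b_def by (intro add_left_mono mult_left_mono nn_integral_Phi_square_le t) simp
  also have "\<dots> = ennreal (a powr p + a powr (p - 2) * b)"
    using b by (simp flip: ennreal_mult ennreal_plus)
  also have "a powr (p - 2) * b = b powr ((p - 2) / 2) * b powr 1"
    using b by (simp add: a_def powr_powr)
  also have "\<dots> = b powr (p / 2)"
    by (simp only: powr_add[symmetric]) (simp add: diff_divide_distrib)
  finally show ?thesis
    by (simp add: a_def powr_powr b_def)
qed

section \<open>Almost every sequence lies in \<open>A p\<close> for \<open>p < 2\<close>\<close>

interpretation nu_lborel: pair_sigma_finite \<nu> lborel ..

text \<open>The measurability clause of \<open>in_Lp\<close> holds for every
  \<open>\<Phi> \<omega>\<close>, so \<open>A p\<close> is where a measurable function on
  \<open>space \<nu>\<close> is finite.\<close>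

lemma A_eq_nn_integral_finite:
  "A p = {\<omega> \<in> space \<nu>. (\<integral>\<^sup>+ t\<in>{0<..}. ennreal (\<bar>\<Phi> \<omega> t\<bar> powr p) \<partial>lborel) < \<infinity>}"
  by (auto simp: A_def in_Lp_def space_nu set_borel_measurable_def)

lemma measurable_nn_integral_Phi_powr:
  "(\<lambda>\<omega>. \<integral>\<^sup>+ t\<in>{0<..}. ennreal (\<bar>\<Phi> \<omega> t\<bar> powr p) \<partial>lborel) \<in> borel_measurable \<nu>"
  by measurable

lemma A_measurable: "A p \<in> sets \<nu>"
  unfolding A_eq_nn_integral_finite
  by (rule borel_measurable_less measurable_nn_integral_Phi_powr borel_measurable_const)+

lemma AE_in_A:
  assumes p: "0 < p" "p < 2"
  shows "AE \<omega> in \<nu>. \<omega> \<in> A p"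
proof -
  have "(\<integral>\<^sup>+ \<omega>. (\<integral>\<^sup>+ t\<in>{0<..}. ennreal (\<bar>\<Phi> \<omega> t\<bar> powr p) \<partial>lborel) \<partial>\<nu>)
      = (\<integral>\<^sup>+ t. (\<integral>\<^sup>+ \<omega>. ennreal (\<bar>\<Phi> \<omega> t\<bar> powr p) * indicator {0<..} t \<partial>\<nu>) \<partial>lborel)"
    by (rule nu_lborel.Fubini'[symmetric]) measurable
  also have "\<dots> \<le> (\<integral>\<^sup>+ t. ennreal 2 * (ennreal ((1 / (exp t - 1)) powr (p / 2)) * indicator {0<..} t) \<partial>lborel)"
    using p by (intro nn_integral_mono)
      (auto split: split_indicator simp: ennreal_mult dest: nn_integral_Phi_powr_le[of _ p])
  also have "\<dots> = ennreal 2 * (\<integral>\<^sup>+ t\<in>{0<..}. ennreal ((1 / (exp t - 1)) powr (p / 2)) \<partial>lborel)"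
    by (rule nn_integral_cmult) measurable
  also have "\<dots> < \<infinity>"
    \<comment> \<open>Here \<open>p < 2\<close> enters: halving the exponent brings it below
      1.\<close>
    using nn_integral_bound_powr_finite[of "p / 2"] p by (simp add: ennreal_mult_less_top)
  finally have "AE \<omega> in \<nu>. (\<integral>\<^sup>+ t\<in>{0<..}. ennreal (\<bar>\<Phi> \<omega> t\<bar> powr p) \<partial>lborel) \<noteq> \<infinity>"
    by (intro nn_integral_PInf_AE measurable_nn_integral_Phi_powr) auto
  with AE_space show ?thesis
    by eventually_elim (simp add: A_eq_nn_integral_finite less_top)
qed

section \<open>Topological size of \<open>A p\<close> for \<open>p \<ge> 1\<close>\<close>

lemma set_integrable_Phi:
  assumes "\<omega> \<in> Gseq" and \<epsilon>: "0 < \<epsilon>"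
  shows "set_integrable lborel {\<epsilon>..1} (\<Phi> \<omega>)"
  unfolding set_integrable_def
proof (rule integrableI_bounded_set_indicator[where B = "1 / (exp \<epsilon> - 1)"])
  have "\<bar>\<Phi> \<omega> t\<bar> \<le> 1 / (exp \<epsilon> - 1)" if "\<epsilon> \<le> t" for t
  proof -
    have "\<bar>\<Phi> \<omega> t\<bar> \<le> 1 / (exp t - 1)"
      using assms that by (intro abs_Phi_le) auto
    also have "\<dots> \<le> 1 / (exp \<epsilon> - 1)"
      using \<epsilon> that by (intro divide_left_mono) auto
    finally show ?thesis .
  qed
  then show "AE t in lborel. t \<in> {\<epsilon>..1} \<longrightarrow> norm (\<Phi> \<omega> t) \<le> 1 / (exp \<epsilon> - 1)"
    by auto
qed (auto simp: emeasure_lborel_Icc_eq)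

lemma set_integrable_const_Icc: "set_integrable lborel {a..b::real} (\<lambda>_. c :: real)"
  by (intro borel_integrable_atLeastAtMost' continuous_on_const)

lemma set_integral_diff_const_Icc:
  fixes f :: "real \<Rightarrow> real"
  assumes "set_integrable lborel {a..b} f" and "a \<le> b"
  shows "(LBINT t:{a..b}. f t - c) = (LBINT t:{a..b}. f t) - c * (b - a)"
proof -
  have "(LBINT t:{a..b}. c) = c * (b - a)"
    using assms(2) by (simp add: set_lebesgue_integral_def)
  then show ?thesis
    by (simp add: set_integral_diff(2)[OF assms(1) set_integrable_const_Icc])
qed

text \<open>The interval has length at most 1, so a pointwise loss \<open>c\<close> costs at most
  \<open>c\<close> in the integral. This serves both the openness and the density argument.\<close>

lemma set_integral_ge_minus_const:
  fixes f g :: "real \<Rightarrow> real"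
  assumes "set_integrable lborel {a..1} f" and "set_integrable lborel {a..1} g"
    and "0 \<le> a" "a \<le> 1" "0 \<le> c" and ge: "\<And>t. a \<le> t \<Longrightarrow> t \<le> 1 \<Longrightarrow> f t - c \<le> g t"
  shows "(LBINT t:{a..1}. f t) - c \<le> (LBINT t:{a..1}. g t)"
proof -
  have "(LBINT t:{a..1}. f t) - c \<le> (LBINT t:{a..1}. f t) - c * (1 - a)"
    using assms by (simp add: mult_left_le)
  also have "\<dots> = (LBINT t:{a..1}. f t - c)"
    using assms by (simp add: set_integral_diff_const_Icc)
  also have "\<dots> \<le> (LBINT t:{a..1}. g t)"
    using assms by (intro set_integral_mono set_integral_diff(1) set_integrable_const_Icc) auto
  finally show ?thesis .
qed

text \<open>The signed integral replaces that of \<open>\<bar>\<Phi> \<omega> t\<bar>\<close>, which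
  it bounds from below. Staying away from 0 keeps \<open>\<Phi> \<omega>\<close> bounded and hence
  integrable, and the strict inequality leaves room for perturbing \<open>\<omega>\<close>.\<close>

definition large_integral :: "nat \<Rightarrow> (nat \<Rightarrow> int) set"
  where "large_integral k =
    {\<omega> \<in> Gseq. \<exists>\<epsilon>. 0 < \<epsilon> \<and> \<epsilon> < 1 \<and> real k < (LBINT t:{\<epsilon>..1}. \<Phi> \<omega> t)}"

lemma openin_large_integral: "openin Gseq_topology (large_integral k)"
  unfolding Gseq_topology_def openin_product_topology_alt
proof
  fix \<omega> assume "\<omega> \<in> large_integral k"
  then obtain \<epsilon> where \<omega>: "\<omega> \<in> Gseq" and \<epsilon>: "0 < \<epsilon>" "\<epsilon> < 1"
    and k: "real k < (LBINT t:{\<epsilon>..1}. \<Phi> \<omega> t)"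
    by (auto simp: large_integral_def)
  \<comment> \<open>The error of \<open>Phi_agree_le\<close> tends to 0, so some \<open>N\<close>
    brings it below the slack in the strict inequality.\<close>
  have "(\<lambda>N. 2 * exp (- \<epsilon>) ^ N / (exp \<epsilon> - 1)) \<longlonglongrightarrow> 2 * 0 / (exp \<epsilon> - 1)"
    using \<epsilon> by (intro tendsto_intros LIMSEQ_power_zero) auto
  then have "\<forall>\<^sub>F N in sequentially. 2 * exp (- \<epsilon>) ^ N / (exp \<epsilon> - 1) < (LBINT t:{\<epsilon>..1}. \<Phi> \<omega> t) - real k"
    using k by (intro order_tendstoD(2)) auto
  then obtain N where N: "2 * exp (- \<epsilon>) ^ N / (exp \<epsilon> - 1) < (LBINT t:{\<epsilon>..1}. \<Phi> \<omega> t) - real k"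
    by (auto simp: eventually_sequentially)
  define c where "c = 2 * exp (- (real N * \<epsilon>)) / (exp \<epsilon> - 1)"
  have c: "c < (LBINT t:{\<epsilon>..1}. \<Phi> \<omega> t) - real k"
    using N exp_of_nat_mult[of N "- \<epsilon>"] by (simp add: c_def)
  \<comment> \<open>The cylinder of sequences that agree with \<open>\<omega>\<close> up to index
    \<open>N\<close>.\<close>
  define V where "V i = (if i \<le> N then {\<omega> i} else G)" for i
  have \<omega>G: "\<omega> i \<in> G" if "i \<ge> 1" for i
    using \<omega> that by (auto simp: Gseq_def PiE_iff)
  have "\<omega>' \<in> large_integral k" if \<omega>': "\<omega>' \<in> Pi\<^sub>E {1..} V" for \<omega>'
  proof -
    have agree: "\<omega> n = \<omega>' n" if "1 \<le> n" "n \<le> N" for n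
      using \<omega>' that by (auto simp: PiE_iff V_def dest!: bspec[of _ _ n])
    have "\<omega>' n \<in> G" if "1 \<le> n" for n
      using \<omega>' that \<omega>G[OF that] by (auto simp: PiE_iff V_def split: if_splits dest!: bspec[of _ _ n])
    then have \<omega>'G: "\<omega>' \<in> Gseq"
      using \<omega>' by (auto simp: Gseq_def PiE_iff)
    have "(LBINT t:{\<epsilon>..1}. \<Phi> \<omega> t) - c \<le> (LBINT t:{\<epsilon>..1}. \<Phi> \<omega>' t)"
    proof (rule set_integral_ge_minus_const)
      fix t assume "\<epsilon> \<le> t"
      then have "\<bar>\<Phi> \<omega> t - \<Phi> \<omega>' t\<bar> \<le> c"
        unfolding c_def using \<epsilon> by (intro Phi_agree_le \<omega> \<omega>'G agree)
      then show "\<Phi> \<omega> t - c \<le> \<Phi> \<omega>' t" by simp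
    qed (use \<epsilon> \<omega> \<omega>'G in \<open>auto intro: set_integrable_Phi simp: c_def\<close>)
    then show ?thesis
      using c \<epsilon> \<omega>'G by (auto simp: large_integral_def intro!: exI[of _ \<epsilon>])
  qed
  moreover have "finite {i \<in> {1..}. V i \<noteq> topspace (discrete_topology G)}"
    by (rule finite_subset[of _ "{..N}"]) (auto simp: V_def split: if_splits)
  moreover have "\<forall>i\<in>{1..}. openin (discrete_topology G) (V i)"
    using \<omega>G by (auto simp: V_def)
  moreover have "\<omega> \<in> Pi\<^sub>E {1..} V"
    using \<omega> by (auto simp: Gseq_def PiE_iff V_def)
  ultimately show "\<exists>U. finite {i \<in> {1..}. U i \<noteq> topspace (discrete_topology G)} \<and>
      (\<forall>i\<in>{1..}. openin (discrete_topology G) (U i)) \<and> \<omega> \<in> Pi\<^sub>E {1..} U \<and> Pi\<^sub>E {1..} U \<subseteq> large_integral k"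
    by blast
qed

lemma eventually_one_in_large_integral:
  assumes \<omega>: "\<omega> \<in> Gseq" and one: "\<And>n. n > N \<Longrightarrow> \<omega> n = 1"
  shows "\<omega> \<in> large_integral k"
proof -
  define c where "c = 2 * real N + 1"
  \<comment> \<open>Chosen so that the integral of \<open>1 / t\<close> over
    \<open>{\<epsilon>..1}\<close> is \<open>real k + c + 1\<close>, which still exceeds
    \<open>k\<close> after the loss of \<open>c\<close>.\<close>
  define \<epsilon> where "\<epsilon> = exp (- (real k + c + 1))"
  have \<epsilon>: "0 < \<epsilon>" "\<epsilon> < 1"
    by (simp_all add: \<epsilon>_def c_def)
  have cont: "continuous_on {\<epsilon>..1} (\<lambda>t. 1 / t)"
    using \<epsilon> by (intro continuous_intros) auto
  have "(LBINT t:{\<epsilon>..1}. 1 / t) = ln 1 - ln \<epsilon>"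
    unfolding set_lebesgue_integral_def
  proof (rule integral_FTC_atLeastAtMost[OF _ _ cont])
    fix t assume "\<epsilon> \<le> t"
    then show "(ln has_vector_derivative 1 / t) (at t within {\<epsilon>..1})"
      using \<epsilon> by (auto intro!: derivative_eq_intros simp flip: has_real_derivative_iff_has_vector_derivative)
  qed (use \<epsilon> in simp)
  also have "\<dots> = real k + c + 1"
    by (simp add: \<epsilon>_def)
  finally have "(LBINT t:{\<epsilon>..1}. 1 / t) = real k + c + 1" .
  moreover have "(LBINT t:{\<epsilon>..1}. 1 / t) - c \<le> (LBINT t:{\<epsilon>..1}. \<Phi> \<omega> t)"
  proof (rule set_integral_ge_minus_const)
    show "set_integrable lborel {\<epsilon>..1} (\<lambda>t. 1 / t)"
      by (rule borel_integrable_atLeastAtMost'[OF cont])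
    fix t assume "\<epsilon> \<le> t"
    then show "1 / t - c \<le> \<Phi> \<omega> t"
      unfolding c_def using \<epsilon> by (intro Phi_eventually_one_ge \<omega> one) auto
  qed (use \<epsilon> \<omega> in \<open>auto intro: set_integrable_Phi simp: c_def\<close>)
  ultimately show ?thesis
    using \<epsilon> \<omega> by (auto simp: large_integral_def intro!: exI[of _ \<epsilon>])
qed

text \<open>A basic open set restricts finitely many coordinates. Setting all coordinates beyond the
  last restricted one to 1 stays inside it and gives a point of every
  \<open>large_integral k\<close>.\<close>

lemma dense_Inter_large_integral: "dense_in Gseq_topology (\<Inter>k. large_integral k)"
  unfolding dense_in_def topspace_Gseq_topology
proof
  show "(\<Inter>k. large_integral k) \<subseteq> Gseq"
    by (auto simp: large_integral_def)
  have "\<exists>\<omega>'. \<omega>' \<in> (\<Inter>k. large_integral k) \<and> \<omega>' \<in> T"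
    if \<omega>: "\<omega> \<in> T" and T: "openin Gseq_topology T" for \<omega> T
  proof -
    obtain V where fin: "finite {i \<in> {1..}. V i \<noteq> G}"
      and V: "\<omega> \<in> Pi\<^sub>E {1..} V" "Pi\<^sub>E {1..} V \<subseteq> T"
      using T \<omega> unfolding Gseq_topology_def openin_product_topology_alt by fastforce
    obtain N where N: "\<And>i. i \<ge> 1 \<Longrightarrow> V i \<noteq> G \<Longrightarrow> i \<le> N"
      using finite_nat_set_iff_bounded_le[THEN iffD1, OF fin] by blast
    define \<omega>' where "\<omega>' n = (if n > N then 1 else \<omega> n)" for n
    have "T \<subseteq> Gseq"
      using openin_subset[OF T] by (simp add: topspace_Gseq_topology)
    have "\<omega>' \<in> Pi\<^sub>E {1..} V"
      using V N by (force simp: \<omega>'_def PiE_iff extensional_def G_def)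
    then have "\<omega>' \<in> T" using V by blast
    moreover have "\<omega>' \<in> large_integral k" for k
      using \<open>\<omega>' \<in> T\<close> \<open>T \<subseteq> Gseq\<close>
      by (intro eventually_one_in_large_integral[of _ N]) (auto simp: \<omega>'_def)
    ultimately show ?thesis by blast
  qed
  then show "Gseq_topology closure_of (\<Inter>k. large_integral k) = Gseq"
    using closure_of_subset_topspace[of Gseq_topology "\<Inter>k. large_integral k"]
    by (auto simp: in_closure_of topspace_Gseq_topology)
qed

text \<open>For \<open>p \<ge> 1\<close>,
  \<open>\<bar>x\<bar> \<le> 1 + \<bar>x\<bar> powr p\<close>. If the \<open>p\<close>-th power
  integral has the finite value \<open>r\<close>, all integrals over \<open>{\<epsilon>..1}\<close>
  are therefore at most \<open>1 + r\<close>, and one \<open>k\<close> above this bound excludes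
  \<open>\<omega>\<close>.\<close>

lemma A_disjoint_Inter_large_integral:
  assumes p: "1 \<le> p"
  shows "A p \<inter> (\<Inter>k. large_integral k) = {}"
proof -
  have "\<exists>k. \<omega> \<notin> large_integral k" if A: "\<omega> \<in> A p" for \<omega>
  proof -
    have \<omega>: "\<omega> \<in> Gseq" using A by (simp add: A_def)
    obtain r where r: "0 \<le> r"
      and J: "(\<integral>\<^sup>+ t\<in>{0<..}. ennreal (\<bar>\<Phi> \<omega> t\<bar> powr p) \<partial>lborel) = ennreal r"
      using A by (cases "\<integral>\<^sup>+ t\<in>{0<..}. ennreal (\<bar>\<Phi> \<omega> t\<bar> powr p) \<partial>lborel")
        (auto simp: A_eq_nn_integral_finite)
    have le: "\<bar>x\<bar> \<le> 1 + \<bar>x\<bar> powr p" for x :: real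
    proof (cases "\<bar>x\<bar> \<le> 1")
      case False
      then show ?thesis
        using powr_mono[of 1 p "\<bar>x\<bar>"] p by simp
    qed (simp add: add_increasing2)
    have le': "ennreal \<bar>x\<bar> \<le> 1 + ennreal (\<bar>x\<bar> powr p)" for x :: real
      using ennreal_leI[OF le[of x]] by (simp add: ennreal_plus)
    have bound: "(LBINT t:{\<epsilon>..1}. \<Phi> \<omega> t) \<le> 1 + r" if \<epsilon>: "0 < \<epsilon>" for \<epsilon>
    proof -
      have "ennreal (norm (LBINT t:{\<epsilon>..1}. \<Phi> \<omega> t))
          \<le> (\<integral>\<^sup>+ t. ennreal (norm (indicator {\<epsilon>..1} t *\<^sub>R \<Phi> \<omega> t)) \<partial>lborel)"
        using set_integrable_Phi[OF \<omega> \<epsilon>]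
        unfolding set_integrable_def set_lebesgue_integral_def by (rule integral_norm_bound_ennreal)
      also have "\<dots> \<le> (\<integral>\<^sup>+ t. indicator {0..1} t
          + ennreal (\<bar>\<Phi> \<omega> t\<bar> powr p) * indicator {0<..} t \<partial>lborel)"
        using \<epsilon> le' by (intro nn_integral_mono) (auto split: split_indicator)
      also have "\<dots> = ennreal (1 + r)"
        using r by (subst nn_integral_add) (auto simp: J)
      finally show ?thesis
        using r by (subst (asm) ennreal_le_iff) auto
    qed
    have "(LBINT t:{\<epsilon>..1}. \<Phi> \<omega> t) \<le> real (nat \<lceil>1 + r\<rceil>)" if "0 < \<epsilon>" for \<epsilon>
      using bound[OF that] real_nat_ceiling_ge[of "1 + r"] by (rule order_trans)
    then have "\<omega> \<notin> large_integral (nat \<lceil>1 + r\<rceil>)"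
      unfolding large_integral_def by (blast dest: leD)
    then show ?thesis ..
  qed
  then show ?thesis by blast
qed

text \<open>No point of \<open>A p\<close> lies in every \<open>large_integral k\<close>, so the
  differences \<open>A p - large_integral k\<close> cover \<open>A p\<close>. Each lies in the
  closed complement of a set that contains a dense one.\<close>

lemma meagre_A:
  assumes p: "1 \<le> p"
  shows "meagre_in Gseq_topology (A p)"
  unfolding meagre_in_def
proof (intro exI conjI ballI)
  show "countable (range (\<lambda>k. A p - large_integral k))"
    by simp
  show "A p = \<Union> (range (\<lambda>k. A p - large_integral k))"
    using A_disjoint_Inter_large_integral[OF p] by blast
  fix S assume "S \<in> range (\<lambda>k. A p - large_integral k)"
  then obtain k where S: "S = A p - large_integral k" by blast
  have "closedin Gseq_topology (Gseq - large_integral k)"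
    using closedin_diff[OF closedin_topspace openin_large_integral]
    by (simp add: topspace_Gseq_topology)
  then have cl: "Gseq_topology closure_of S \<subseteq> Gseq - large_integral k"
    by (intro closure_of_minimal) (auto simp: S A_def)
  have "Gseq_topology interior_of (Gseq_topology closure_of S) = {}"
  proof (rule ccontr)
    assume "Gseq_topology interior_of (Gseq_topology closure_of S) \<noteq> {}"
    then obtain x where x: "x \<in> Gseq_topology interior_of (Gseq_topology closure_of S)"
      by blast
    \<comment> \<open>The interior is an open neighbourhood of \<open>x\<close>, so it meets the
      dense intersection; but the closure of \<open>S\<close> avoids
      \<open>large_integral k\<close>.\<close>
    then have "x \<in> Gseq_topology closure_of (\<Inter>k. large_integral k)"
      using dense_Inter_large_integral interior_of_subset_topspace
      unfolding dense_in_def by fastforce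
    then obtain y where "y \<in> (\<Inter>k. large_integral k)"
      "y \<in> Gseq_topology interior_of (Gseq_topology closure_of S)"
      using x openin_interior_of unfolding in_closure_of by blast
    then show False
      using cl interior_of_subset[of Gseq_topology "Gseq_topology closure_of S"] by blast
  qed
  then show "nowhere_dense_in Gseq_topology S"
    by (auto simp: nowhere_dense_in_def S A_def topspace_Gseq_topology)
qed

theorem proposition8p1:
  shows "(\<forall>p::real. 0 < p \<and> p < 1 \<longrightarrow> A p = Gseq) \<and>
    (\<forall>p::real. 1 \<le> p \<and> p < 2 \<longrightarrow>
      (A p \<in> sets \<nu> \<and> emeasure \<nu> (A p) = 1 \<and> meagre_in Gseq_topology (A p)) \<and>
      (Gseq - A p \<in> null_sets \<nu> \<and>
       (\<exists>D. D \<subseteq> Gseq - A p \<and> gdelta_in Gseq_topology D \<and> dense_in Gseq_topology D)))"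
proof (intro conjI allI impI; elim conjE)
  fix p :: real
  assume p: "1 \<le> p" "p < 2"
  then have AE: "AE \<omega> in \<nu>. \<omega> \<in> A p"
    by (intro AE_in_A) auto
  show "A p \<in> sets \<nu>"
    by (rule A_measurable)
  show "emeasure \<nu> (A p) = 1"
    using AE A_measurable by (rule nu.emeasure_eq_1_AE[rotated])
  show "meagre_in Gseq_topology (A p)"
    using p(1) by (rule meagre_A)
  show "Gseq - A p \<in> null_sets \<nu>"
  proof -
    have "Gseq - A p = {\<omega> \<in> space \<nu>. \<not> \<omega> \<in> A p}"
      by (auto simp: space_nu)
    moreover have "{\<omega> \<in> space \<nu>. \<not> \<omega> \<in> A p} \<in> sets \<nu>"
      using A_measurable[of p] sets.compl_sets[of "A p" \<nu>] calculation by (simp add: space_nu)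
    ultimately show ?thesis
      using AE by (simp add: AE_iff_null)
  qed
  show "\<exists>D. D \<subseteq> Gseq - A p \<and> gdelta_in Gseq_topology D \<and> dense_in Gseq_topology D"
  proof (intro exI conjI)
    show "(\<Inter>k. large_integral k) \<subseteq> Gseq - A p"
      using A_disjoint_Inter_large_integral[OF p(1)] by (auto simp: large_integral_def)
    show "gdelta_in Gseq_topology (\<Inter>k. large_integral k)"
      by (intro gdelta_in_Inter) (auto intro: open_imp_gdelta_in openin_large_integral)
  qed (rule dense_Inter_large_integral)
qed (rule A_eq_Gseq)

end
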